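(* Let $N$ be a positive integer, and let $e, d$ be integers with $1 \leq e, d \leq \phi(N)$ and $e d \equiv 1 \pmod{\phi(N)}$. Then for every integer $m \in \Phi\text{-set}(N)$ we have $$(m^e)^d \equiv m \pmod{N}.$$
   Context: $\phi$ denotes Euler's totient function: $\phi(N)$ is the number of integers from $1$ to $N$ that are coprime to $N$. For a positive integer $N$, the set $\Phi\text{-set}(N)$ is defined as the set of all integers $m$ with $1 \leq m \leq N$ such that, writing $P = \gcd(m, N)$ and $Q = N / P$, one has $\gcd(P, Q) = 1$. In the extended RSA encryption scheme with modulus $N$ and keys $e, d$ as in the claim, encryption is $\mathrm{Enc}(m) = m^e \bmod N$ and decryption is $\mathrm{Dec}(c) = c^d \bmod N$; the correctness condition for a message $m$ is $(m^e)^d \equiv m \pmod N$. *)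

theory Defs
  imports "HOL-Number_Theory.Number_Theory"
begin

(* All integers involved are positive, so they are represented as naturals.
   The division N div P is exact, because P = gcd m N divides N. *)
definition Phi_set :: "nat \<Rightarrow> nat set" where
  "Phi_set N = {m. 1 \<le> m \<and> m \<le> N \<and>
     (let P = gcd m N; Q = N div P in gcd P Q = 1)}"

end

theory Submission
  imports Defs
begin

text \<open>Split N into the coprime factors P = gcd m N and Q = N / P. Modulo P both sides vanish.
  The number m is coprime to Q, since a common divisor of m and Q divides both P and Q; so the
  congruence modulo Q is Euler's theorem, because \<open>totient Q\<close> divides \<open>totient N\<close>.\<close>

theorem theorem6p2:
  fixes N e d :: nat
  assumes "N > 0"
    and "1 \<le> e" and "e \<le> totient N"
    and "1 \<le> d" and "d \<le> totient N"
    and "[e * d = 1] (mod totient N)"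
  shows "\<forall>m \<in> Phi_set N. [(m ^ e) ^ d = m] (mod N)"
proof
  fix m assume m: "m \<in> Phi_set N"
  define P where "P = gcd m N"
  define Q where "Q = N div P"
  have PQ: "coprime P Q"
    using m unfolding Phi_set_def Let_def P_def Q_def coprime_iff_gcd_eq_1 by blast
  have N: "N = P * Q"
    unfolding P_def Q_def by simp
  have "coprime m Q"
  proof (rule coprimeI)
    fix c assume "c dvd m" "c dvd Q"
    \<comment> \<open>As \<open>Q\<close> divides \<open>N\<close>, \<open>c\<close> divides both
      \<open>m\<close> and \<open>N\<close>, hence their gcd.\<close>
    moreover from this have "c dvd P"
      unfolding P_def by (intro gcd_greatest) (simp_all add: N)
    ultimately show "is_unit c"
      using PQ coprime_common_divisor by blast
  qed
  \<comment> \<open>Used twice: to read the congruence as an equation with a natural quotient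
    \<open>k\<close>, and to keep \<open>P\<close> a divisor of \<open>m ^ (e * d)\<close>.\<close>
  have "e * d \<ge> 1"
    using assms(2,4) mult_le_mono by fastforce
  then obtain k where k: "e * d = k * totient N + 1"
    using assms(6) by (auto simp only: cong_le_nat)
  have "[(m ^ e) ^ d = m] (mod P)"
  proof -
    have "P dvd m" by (simp add: P_def)
    then have "P dvd m ^ (e * d)"
      using dvd_power_le[of P m 1 "e * d"] \<open>e * d \<ge> 1\<close> by simp
    with \<open>P dvd m\<close> show ?thesis
      by (simp add: power_mult cong_def mod_eq_0_iff_dvd)
  qed
  moreover have "[(m ^ e) ^ d = m] (mod Q)"
  proof -
    have "totient N = totient Q * totient P"
      using PQ by (simp add: N totient_mult_coprime)
    \<comment> \<open>The \<open>+ 1\<close> in the exponent yields the separate factor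
      \<open>m\<close>; the rest is a power of \<open>m ^ totient Q\<close>, which is 1 modulo
      \<open>Q\<close>.\<close>
    then have "(m ^ e) ^ d = m * (m ^ totient Q) ^ (k * totient P)"
      unfolding power_mult[symmetric] k by (simp add: ac_simps)
    moreover have "[m * (m ^ totient Q) ^ (k * totient P) = m * 1 ^ (k * totient P)] (mod Q)"
      using \<open>coprime m Q\<close> by (intro cong_mult cong_pow cong_refl euler_theorem)
    ultimately show ?thesis by simp
  qed
  ultimately show "[(m ^ e) ^ d = m] (mod N)"
    unfolding N using PQ by (rule coprime_cong_mult_nat)
qed

end
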